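(* There exists a constant $c>0$ such that for every graph $G$ with average degree $d>1$ and for every field $\mathbb{F}$, \[\mathrm{ch\text{-}s}(G,\mathbb{F}) > c \cdot \sqrt{\frac{d}{\ln d}}.\]
   Context: Graphs are finite, simple and undirected; the average degree of $G=(V,E)$ is $2|E|/|V|$. Inner product: on $\mathbb{C}^t$, $\langle x,y\rangle=\sum_i x_i\overline{y_i}$; on $\mathbb{F}^t$ for every other field $\mathbb{F}$ (in particular $\mathbb{R}$ and finite fields), $\langle x,y\rangle=\sum_i x_iy_i$. Vectors $x,y$ are orthogonal if $\langle x,y\rangle=0$. A graph $G=(V,E)$ is $k$-subspace choosable over $\mathbb{F}$ if for every integer $t$ and every assignment of subspaces $W_v\subseteq\mathbb{F}^t$ with $\dim(W_v)=k$ to the vertices $v\in V$, there exists a choice of a nonzero vector $x_v\in W_v$ for each $v\in V$ such that $\langle x_v,x_{v'}\rangle=0$ whenever $v$ and $v'$ are adjacent in $G$. The subspace choice number $\mathrm{ch\text{-}s}(G,\mathbb{F})$ is the smallest positive integer $k$ for which $G$ is $k$-subspace choosable over $\mathbb{F}$.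
   Formalization: As written it fails: m disjoint edges plus a 3-vertex path have ch-s ≤ 2 while d→1 and d/ln d→∞. Proved: for each d0>1 there is c>0 valid for all graphs with d≥d0. Graphs and fields range over one type each; c for all follows by placing countably many counterexamples in one type. *)

theory Defs
  imports
    Complex_Main
    "HOL-Algebra.QuotRing"
    "HOL-Algebra.Algebraic_Closure_Type"
    "Jordan_Normal_Form.Missing_VectorSpace"
begin

definition simple_graph :: "'v set \<Rightarrow> 'v set set \<Rightarrow> bool" where
  "simple_graph V E \<longleftrightarrow> finite V \<and> (\<forall>e\<in>E. e \<subseteq> V \<and> card e = 2)"

definition average_degree :: "'v set \<Rightarrow> 'v set set \<Rightarrow> real" where
  "average_degree V E = 2 * real (card E) / real (card V)"

text \<open>A field is a record with an explicit carrier, not a type of class \<open>field\<close>: only then can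
  a statement choose a constant first and quantify over all fields afterwards.\<close>

abbreviation complex_field :: "complex ring" where
  "complex_field \<equiv> ring_of_type_algebra"

text \<open>The coordinate space \<open>F\<^sup>t\<close>: coordinates are indexed by \<open>{..<t}\<close>, and vectors are
  \<open>undefined\<close> outside of it.\<close>

abbreviation coord_space :: "'a ring \<Rightarrow> nat \<Rightarrow> ('a, nat \<Rightarrow> 'a) module" where
  "coord_space F t \<equiv> ring.func_space F {..<t}"

text \<open>The map \<open>\<sigma>\<close> is applied to the second argument. It is \<open>cnj\<close> for the complex
  numbers and the identity for every other field.\<close>

definition inner_prod :: "'a ring \<Rightarrow> ('a \<Rightarrow> 'a) \<Rightarrow> nat \<Rightarrow> (nat \<Rightarrow> 'a) \<Rightarrow> (nat \<Rightarrow> 'a) \<Rightarrow> 'a" where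
  "inner_prod F \<sigma> t x y = (\<Oplus>\<^bsub>F\<^esub> i\<in>{..<t}. x i \<otimes>\<^bsub>F\<^esub> \<sigma> (y i))"

definition subspace_choosable ::
    "'v set \<Rightarrow> 'v set set \<Rightarrow> 'a ring \<Rightarrow> ('a \<Rightarrow> 'a) \<Rightarrow> nat \<Rightarrow> bool" where
  "subspace_choosable V E F \<sigma> k \<longleftrightarrow>
     (\<forall>t W. (\<forall>v\<in>V. VectorSpace.subspace F (W v) (coord_space F t) \<and>
                  vectorspace.dim F ((coord_space F t)\<lparr>carrier := W v\<rparr>) = k) \<longrightarrow>
        (\<exists>x. (\<forall>v\<in>V. x v \<in> W v \<and> x v \<noteq> \<zero>\<^bsub>coord_space F t\<^esub>) \<and>
             (\<forall>u v. {u, v} \<in> E \<longrightarrow> inner_prod F \<sigma> t (x u) (x v) = \<zero>\<^bsub>F\<^esub>)))"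

definition subspace_choice_number ::
    "'v set \<Rightarrow> 'v set set \<Rightarrow> 'a ring \<Rightarrow> ('a \<Rightarrow> 'a) \<Rightarrow> nat" where
  "subspace_choice_number V E F \<sigma> = (LEAST k. 0 < k \<and> subspace_choosable V E F \<sigma> k)"

end

theory Submission
  imports Defs
begin

text \<open>
  The subspace choice number \<open>k\<close> of a graph of average degree \<open>d\<close> satisfies \<open>k > sqrt (d / 6)\<close>
  over every field; for \<open>d \<ge> d\<^sub>0 > 1\<close> this exceeds a constant multiple of \<open>sqrt (d / ln d)\<close>.

  For the lower bound, let \<open>n\<close> and \<open>m\<close> be the numbers of vertices and edges, and suppose
  \<open>3 k\<^sup>2 n \<le> m\<close>. Label each end \<open>v\<close> of each edge \<open>e\<close> with a set \<open>P e v \<subseteq> {..<k}\<close>, and let \<open>W v\<close>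
  consist of the vectors that have the coordinate \<open>\<Sum>j\<in>P e v. y j\<close> at every edge \<open>e\<close> that contains
  \<open>v\<close>, the coordinates of \<open>y\<close> at \<open>k\<close> places reserved for \<open>v\<close>, and \<open>0\<close> elsewhere, where \<open>y\<close>
  ranges over \<open>F\<^sup>k\<close>. The ends of an edge \<open>e = {u, v}\<close> share the coordinate \<open>e\<close> and no other one.
  So the chosen vectors of \<open>u\<close> and \<open>v\<close> are orthogonal only if \<open>y u\<close> has sum zero over \<open>P e u\<close> or
  \<open>y v\<close> has sum zero over \<open>P e v\<close>, and this depends only on the zero patterns of \<open>y u\<close> and \<open>y v\<close>,
  that is, on the families of sets over which they have sum zero.

  Two facts about zero patterns hold over all fields. The pattern of a nonzero \<open>y\<close> contains at most
  half of the subsets of \<open>{..<k}\<close> (\<open>card_zero_sets\<close>). And there are at most \<open>2\<close> to the power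
  \<open>k\<^sup>2\<close> patterns, because a pattern is the set of 0/1-vectors in a subspace and so is generated by
  at most \<open>k\<close> of its members (\<open>card_zero_patterns\<close>). By the first fact, random labels of one edge
  violate its orthogonality with probability at least \<open>1/4\<close> for any fixed assignment of patterns
  to the vertices. Hence the labels can be chosen edge by edge in such a way that at most
  \<open>(3/4)\<^sup>m\<close> of all assignments of patterns survive (\<open>ex_separating_labelling\<close>). By the second fact
  their number is then less than one, so this choice of subspaces admits no solution
  (\<open>card_edges_less_of_subspace_choosable\<close>).

  The definition of the subspace choice number as a least element also requires that some \<open>k\<close>
  works at all. The number of vertices does, by a greedy choice of the vectors
  (\<open>subspace_choosable_card\<close>). Complex conjugation and the identity are treated together as an
  involutive automorphism \<open>\<sigma>\<close>. All labels are made of zeros and ones, so \<open>\<sigma>\<close> does not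
  interfere with the construction.
\<close>

section \<open>Linear algebra in coordinate spaces\<close>

context field
begin

lemma func_space_vectorspace: "vectorspace R (func_space S)"
  by (simp add: vectorspace_def func_space_is_module field_axioms)

lemma func_space_simps [simp]:
  "carrier (func_space S) = S \<rightarrow>\<^sub>E carrier R"
  "\<zero>\<^bsub>func_space S\<^esub> = (\<lambda>i\<in>S. \<zero>)"
  "x \<oplus>\<^bsub>func_space S\<^esub> y = (\<lambda>i\<in>S. x i \<oplus> y i)"
  "c \<odot>\<^bsub>func_space S\<^esub> x = (\<lambda>i\<in>S. c \<otimes> x i)"
  by (simp_all add: func_space_def)

lemma finsum_func_space_apply:
  assumes "finite A" "f \<in> A \<rightarrow> (S \<rightarrow>\<^sub>E carrier R)" "i \<in> S"
  shows "(\<Oplus>\<^bsub>func_space S\<^esub>a\<in>A. f a) i = (\<Oplus>a\<in>A. f a i)"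
proof -
  interpret M: module R "func_space S" by (rule func_space_is_module)
  show ?thesis
    using assms(1,2)
  proof (induction A)
    case (insert a A)
    have "f \<in> A \<rightarrow> carrier (func_space S)" "f a \<in> carrier (func_space S)"
      "(\<lambda>b. f b i) \<in> A \<rightarrow> carrier R" "f a i \<in> carrier R"
      using insert.prems \<open>i \<in> S\<close> by auto
    then show ?case
      using insert \<open>i \<in> S\<close> by (simp add: M.finsum_insert finsum_insert)
  qed (use \<open>i \<in> S\<close> in simp)
qed

text \<open>The unit vectors form a basis, because the coordinate of a linear combination of them at \<open>j\<close>
  is the coefficient of the \<open>j\<close>-th unit vector.\<close>

lemma func_space_fin_dim_dim:
  assumes "finite S"
  shows "vectorspace.fin_dim R (func_space S)" "vectorspace.dim R (func_space S) = card S"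
proof -
  interpret V: vectorspace R "func_space S" by (rule func_space_vectorspace)
  define e where "e j = (\<lambda>i\<in>S. if i = j then \<one> else \<zero>)" for j
  have inj: "inj_on e S"
  proof (rule inj_onI)
    fix i j assume "i \<in> S" "j \<in> S" "e i = e j"
    then have "e i i = e j i" by simp
    with \<open>i \<in> S\<close> show "i = j" by (auto simp: e_def split: if_splits)
  qed
  have e_carrier: "e ` S \<subseteq> carrier (func_space S)" by (auto simp: e_def)
  have coords: "V.lincomb a (e ` S) j = a (e j)" if a: "a \<in> e ` S \<rightarrow> carrier R" and j: "j \<in> S" for a j
  proof -
    have a_e: "a (e i) \<in> carrier R" if "i \<in> S" for i using a that by blast
    have e_in: "e i j \<in> carrier R" if "i \<in> S" "j \<in> S" for i j using that by (simp add: e_def)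
    have "V.lincomb a (e ` S) j = (\<Oplus>v\<in>e ` S. (a v \<odot>\<^bsub>func_space S\<^esub> v) j)"
      unfolding V.lincomb_def
    proof (rule finsum_func_space_apply)
      show "(\<lambda>v. a v \<odot>\<^bsub>func_space S\<^esub> v) \<in> e ` S \<rightarrow> (S \<rightarrow>\<^sub>E carrier R)"
      proof
        fix v assume "v \<in> e ` S"
        then obtain i where "i \<in> S" "v = e i" by blast
        then show "a v \<odot>\<^bsub>func_space S\<^esub> v \<in> S \<rightarrow>\<^sub>E carrier R" using a_e e_in by simp
      qed
    qed (use j assms in auto)
    also have "\<dots> = (\<Oplus>i\<in>S. (a (e i) \<odot>\<^bsub>func_space S\<^esub> e i) j)"
      using a_e j by (intro finsum_reindex inj) (auto simp: e_def)
    also have "\<dots> = (\<Oplus>i\<in>S. if j = i then a (e i) else \<zero>)"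
      using a_e j by (intro finsum_cong') (auto simp: e_def)
    also have "\<dots> = a (e j)"
      using a_e j assms by (intro finsum_singleton) auto
    finally show ?thesis .
  qed
  have lincomb_carrier: "V.lincomb a (e ` S) \<in> S \<rightarrow>\<^sub>E carrier R" if "a \<in> e ` S \<rightarrow> carrier R" for a
    using V.lincomb_closed[OF e_carrier that] by simp
  have basis: "V.basis (e ` S)"
    unfolding V.basis_criterion[OF finite_imageI[OF assms] e_carrier]
  proof (intro allI impI)
    fix v assume "v \<in> carrier (func_space S)"
    then have v: "v \<in> S \<rightarrow>\<^sub>E carrier R" by simp
    define a where "a = (\<lambda>w\<in>e ` S. v (inv_into S e w))"
    have a: "a \<in> e ` S \<rightarrow>\<^sub>E carrier R"
      using v by (auto simp: a_def inj)
    then have a': "a \<in> e ` S \<rightarrow> carrier R" by auto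
    show "\<exists>!a. a \<in> e ` S \<rightarrow>\<^sub>E carrier R \<and> V.lincomb a (e ` S) = v"
    proof (intro ex1I conjI)
      show "V.lincomb a (e ` S) = v"
        by (rule PiE_ext[OF lincomb_carrier[OF a'] v]) (simp add: coords a', simp add: a_def inj)
    next
      fix b assume b: "b \<in> e ` S \<rightarrow>\<^sub>E carrier R \<and> V.lincomb b (e ` S) = v"
      then have b': "b \<in> e ` S \<rightarrow> carrier R" by auto
      show "b = a"
      proof (rule PiE_ext[OF _ a])
        show "b \<in> e ` S \<rightarrow>\<^sub>E carrier R" using b by simp
        fix w assume "w \<in> e ` S"
        then show "b w = a w" using b coords[OF b'] by (auto simp: a_def inj)
      qed
    qed (rule a)
  qed
  show "V.dim = card S"
    unfolding V.dim_basis[OF finite_imageI[OF assms] basis] by (rule card_image[OF inj])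
  show "V.fin_dim"
    unfolding V.fin_dim_def
    using finite_imageI[OF assms, of e] basis[unfolded V.basis_def] by blast
qed

end

text \<open>A linearly independent subset of the subspace is linearly independent in the whole space, so its
  size is at most \<open>dim\<close>; hence a maximal one exists, and it is a basis of the subspace.
  Finiteness has to be established along with the bound, because \<open>dim\<close> is an arbitrary number
  for a space without a finite generating set.\<close>

lemma (in vectorspace) subspace_fin_dim_dim_le:
  assumes "fin_dim" and "subspace K U V"
  shows "vectorspace.fin_dim K (vs U)" "vectorspace.dim K (vs U) \<le> dim"
proof -
  interpret U: vectorspace K "vs U" by (rule subspace_is_vs[OF assms(2)])
  have sub: "submodule K U V" and "U \<subseteq> carrier V"
    using assms(2) by (auto simp: subspace_def submodule_def)
  have bound: "finite A \<and> card A \<le> dim" if "A \<subseteq> carrier (vs U) \<and> U.lin_indpt A" for A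
  proof -
    have "lin_indpt A" "A \<subseteq> carrier V"
      using that span_li_not_depend(2)[OF _ sub] \<open>U \<subseteq> carrier V\<close> by auto
    then show ?thesis using li_le_dim[OF assms(1)] by blast
  qed
  have "U.lin_indpt {}"
    by (rule U.finite_lin_indpt2) auto
  then obtain A where A: "finite A" "maximal A (\<lambda>S. S \<subseteq> carrier (vs U) \<and> U.lin_indpt S)"
    using maximal_exists[of "\<lambda>S. S \<subseteq> carrier (vs U) \<and> U.lin_indpt S" dim "{}"] bound by blast
  then have "U.basis A" by (intro U.max_li_is_basis)
  then show "U.fin_dim" "U.dim \<le> dim"
    using A(1) bound[of A] U.dim_basis[of A] unfolding U.fin_dim_def U.basis_def by auto
qed

text \<open>Rank-nullity with nullity zero.\<close>

lemma (in linear_map) dim_le_of_trivial_kernel: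
  assumes "V.fin_dim" "W.fin_dim" "\<And>x. x \<in> carrier V \<Longrightarrow> T x = \<zero>\<^bsub>W\<^esub> \<Longrightarrow> x = \<zero>\<^bsub>V\<^esub>"
  shows "vectorspace.dim K (W.vs imT) = V.dim" "V.dim \<le> W.dim"
proof -
  have "carrier (V.vs kerT) = {\<zero>\<^bsub>V\<^esub>}"
    using assms(3) by (auto simp: ker_def)
  then have "vectorspace.dim K (V.vs kerT) = 0"
    by (intro inj_imp_dim_ker0 Ke0_imp_inj)
  then show "vectorspace.dim K (W.vs imT) = V.dim"
    using rank_nullity[OF assms(1)] by simp
  then show "V.dim \<le> W.dim"
    using W.subspace_fin_dim_dim_le(2)[OF assms(2) imT_is_subspace] by simp
qed

context field
begin

definition mat_map :: "nat \<Rightarrow> nat \<Rightarrow> (nat \<Rightarrow> nat \<Rightarrow> 'a) \<Rightarrow> (nat \<Rightarrow> 'a) \<Rightarrow> nat \<Rightarrow> 'a" where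
  "mat_map t k A y = (\<lambda>i\<in>{..<t}. \<Oplus>j\<in>{..<k}. A i j \<otimes> y j)"

lemma mat_map_linear:
  assumes A: "\<And>i j. i < t \<Longrightarrow> j < k \<Longrightarrow> A i j \<in> carrier R"
    and U: "subspace R U (func_space {..<k})"
  shows "linear_map R ((func_space {..<k})\<lparr>carrier := U\<rparr>) (func_space {..<t}) (mat_map t k A)"
proof -
  interpret V: vectorspace R "func_space {..<k}" by (rule func_space_vectorspace)
  interpret T: vectorspace R "func_space {..<t}" by (rule func_space_vectorspace)
  interpret U: vectorspace R "V.vs U" by (rule V.subspace_is_vs[OF U])
  have UD: "x j \<in> carrier R" if "x \<in> U" "j < k" for x j
    using U that by (auto simp: subspace_def submodule_def PiE_def Pi_def)
  have summand: "(\<lambda>j. A i j \<otimes> x j) \<in> {..<k} \<rightarrow> carrier R" if "x \<in> U" "i < t" for x i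
    using A UD that by auto
  have "mat_map t k A (x \<oplus>\<^bsub>func_space {..<k}\<^esub> y)
      = mat_map t k A x \<oplus>\<^bsub>func_space {..<t}\<^esub> mat_map t k A y" if "x \<in> U" "y \<in> U" for x y
  proof -
    have "(\<Oplus>j\<in>{..<k}. A i j \<otimes> (\<lambda>j\<in>{..<k}. x j \<oplus> y j) j)
        = (\<Oplus>j\<in>{..<k}. A i j \<otimes> x j) \<oplus> (\<Oplus>j\<in>{..<k}. A i j \<otimes> y j)" if "i < t" for i
      unfolding finsum_addf[OF summand[OF \<open>x \<in> U\<close> that] summand[OF \<open>y \<in> U\<close> that], symmetric]
      using A UD \<open>x \<in> U\<close> \<open>y \<in> U\<close> that by (intro finsum_cong') (auto simp: r_distr)
    then show ?thesis by (auto simp: mat_map_def)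
  qed
  moreover have "mat_map t k A (c \<odot>\<^bsub>func_space {..<k}\<^esub> x)
      = c \<odot>\<^bsub>func_space {..<t}\<^esub> mat_map t k A x" if "c \<in> carrier R" "x \<in> U" for c x
  proof -
    have "(\<Oplus>j\<in>{..<k}. A i j \<otimes> (\<lambda>j\<in>{..<k}. c \<otimes> x j) j)
        = c \<otimes> (\<Oplus>j\<in>{..<k}. A i j \<otimes> x j)" if "i < t" for i
      unfolding finsum_rdistr[OF finite_lessThan \<open>c \<in> carrier R\<close> summand[OF \<open>x \<in> U\<close> that]]
      using A UD \<open>x \<in> U\<close> \<open>c \<in> carrier R\<close> that by (intro finsum_cong') (auto simp: m_ac)
    then show ?thesis by (auto simp: mat_map_def)
  qed
  moreover have "mat_map t k A x \<in> {..<t} \<rightarrow>\<^sub>E carrier R" if "x \<in> U" for x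
    unfolding mat_map_def using summand[OF that] by (auto intro!: finsum_closed)
  ultimately show ?thesis
    by unfold_locales (auto simp: module_hom_def)
qed

text \<open>The form of linear algebra used to choose vectors greedily: a subspace of dimension larger than
  \<open>m\<close> contains a nonzero vector that satisfies any \<open>m\<close> given linear equations.\<close>

lemma subspace_dim_le_of_mat_map_kernel:
  fixes m t :: nat
  assumes A: "\<And>i j. i < m \<Longrightarrow> j < t \<Longrightarrow> A i j \<in> carrier R"
    and U: "subspace R U (func_space {..<t})"
    and ker: "\<And>x. x \<in> U \<Longrightarrow> \<forall>i<m. (\<Oplus>j\<in>{..<t}. A i j \<otimes> x j) = \<zero> \<Longrightarrow> x = \<zero>\<^bsub>func_space {..<t}\<^esub>"
  shows "vectorspace.dim R ((func_space {..<t})\<lparr>carrier := U\<rparr>) \<le> m"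
proof -
  interpret V: vectorspace R "func_space {..<t}" by (rule func_space_vectorspace)
  interpret L: linear_map R "V.vs U" "func_space {..<m}" "mat_map m t A"
    by (rule mat_map_linear[OF A U])
  have "L.V.dim \<le> L.W.dim"
  proof (rule L.dim_le_of_trivial_kernel(2))
    show "L.V.fin_dim"
      by (rule V.subspace_fin_dim_dim_le(1)[OF func_space_fin_dim_dim(1) U]) simp
    show "L.W.fin_dim" by (rule func_space_fin_dim_dim(1)) simp
    fix x assume "x \<in> carrier (V.vs U)" and "mat_map m t A x = \<zero>\<^bsub>func_space {..<m}\<^esub>"
    then have "x \<in> U" and "mat_map m t A x i = (\<lambda>i\<in>{..<m}. \<zero>) i" for i by simp_all
    from this(2) have "\<forall>i<m. (\<Oplus>j\<in>{..<t}. A i j \<otimes> x j) = \<zero>"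
      by (metis (lifting) lessThan_iff mat_map_def restrict_apply')
    then show "x = \<zero>\<^bsub>V.vs U\<^esub>" using ker[OF \<open>x \<in> U\<close>] by simp
  qed
  then show ?thesis by (simp add: func_space_fin_dim_dim(2))
qed

lemma whole_subspace: "subspace R ({..<k} \<rightarrow>\<^sub>E carrier R) (func_space {..<k})"
proof -
  interpret V: vectorspace R "func_space {..<k}" by (rule func_space_vectorspace)
  show ?thesis by unfold_locales (auto simp: PiE_def Pi_def)
qed

lemma func_space_carrier_eq: "(func_space {..<k})\<lparr>carrier := {..<k} \<rightarrow>\<^sub>E carrier R\<rparr> = func_space {..<k}"
  by (simp add: func_space_def)

text \<open>Column spaces of matrices with full column rank are the subspaces that are assigned to the
  vertices in the lower bound.\<close>

lemma mat_map_image_subspace: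
  fixes A k t
  defines "W \<equiv> mat_map t k A ` ({..<k} \<rightarrow>\<^sub>E carrier R)"
  assumes A: "\<And>i j. i < t \<Longrightarrow> j < k \<Longrightarrow> A i j \<in> carrier R"
    and inj: "\<And>y. y \<in> {..<k} \<rightarrow>\<^sub>E carrier R \<Longrightarrow>
                mat_map t k A y = \<zero>\<^bsub>func_space {..<t}\<^esub> \<Longrightarrow> y = \<zero>\<^bsub>func_space {..<k}\<^esub>"
  shows "subspace R W (func_space {..<t})"
    and "vectorspace.dim R ((func_space {..<t})\<lparr>carrier := W\<rparr>) = k"
proof -
  interpret L: linear_map R "func_space {..<k}" "func_space {..<t}" "mat_map t k A"
    using mat_map_linear[OF A whole_subspace] unfolding func_space_carrier_eq .
  have im: "L.im = W" by (simp add: L.im_def W_def)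
  show "subspace R W (func_space {..<t})"
    using L.imT_is_subspace unfolding im .
  show "vectorspace.dim R ((func_space {..<t})\<lparr>carrier := W\<rparr>) = k"
  proof -
    have "vectorspace.dim R ((func_space {..<t})\<lparr>carrier := L.im\<rparr>) = L.V.dim"
      by (rule L.dim_le_of_trivial_kernel(1))
        (use inj in \<open>simp_all add: func_space_fin_dim_dim(1)\<close>)
    then show ?thesis unfolding im by (simp add: func_space_fin_dim_dim(2))
  qed
qed

lemma ex_nontrivial_solution:
  fixes m k :: nat
  assumes "\<And>i j. i < m \<Longrightarrow> j < k \<Longrightarrow> A i j \<in> carrier R" and "m < k"
  obtains y j where "y \<in> {..<k} \<rightarrow>\<^sub>E carrier R" "j < k" "y j \<noteq> \<zero>"
    "\<And>i. i < m \<Longrightarrow> (\<Oplus>j\<in>{..<k}. A i j \<otimes> y j) = \<zero>"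
proof -
  have "\<exists>y\<in>{..<k} \<rightarrow>\<^sub>E carrier R. (\<forall>i<m. (\<Oplus>j\<in>{..<k}. A i j \<otimes> y j) = \<zero>) \<and> y \<noteq> (\<lambda>j\<in>{..<k}. \<zero>)"
  proof (rule ccontr)
    assume *: "\<not> ?thesis"
    have "vectorspace.dim R ((func_space {..<k})\<lparr>carrier := {..<k} \<rightarrow>\<^sub>E carrier R\<rparr>) \<le> m"
    proof (rule subspace_dim_le_of_mat_map_kernel[OF assms(1) whole_subspace])
      fix x assume "x \<in> {..<k} \<rightarrow>\<^sub>E carrier R" "\<forall>i<m. (\<Oplus>j\<in>{..<k}. A i j \<otimes> x j) = \<zero>"
      with * show "x = \<zero>\<^bsub>func_space {..<k}\<^esub>" unfolding func_space_simps by blast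
    qed
    then have "k \<le> m"
      unfolding func_space_carrier_eq by (simp add: func_space_fin_dim_dim)
    with \<open>m < k\<close> show False by simp
  qed
  then obtain y where y: "y \<in> {..<k} \<rightarrow>\<^sub>E carrier R" "y \<noteq> (\<lambda>j\<in>{..<k}. \<zero>)"
    "\<forall>i<m. (\<Oplus>j\<in>{..<k}. A i j \<otimes> y j) = \<zero>" by blast
  moreover have "\<exists>j<k. y j \<noteq> \<zero>"
  proof (rule ccontr)
    assume "\<not> ?thesis"
    then have "y = (\<lambda>j\<in>{..<k}. \<zero>)"
      using y(1) by (intro PiE_ext[where k = "{..<k}" and s = "\<lambda>_. carrier R"]) auto
    with y(2) show False by simp
  qed
  ultimately show ?thesis using that by blast
qed

end

section \<open>Zero patterns of subset sums\<close>

context field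
begin

text \<open>The zero pattern of \<open>y\<close>: the 0/1-vectors of length \<open>k\<close> that are orthogonal to \<open>y\<close>,
  written as subsets of \<open>{..<k}\<close>.\<close>

definition zero_sets :: "nat \<Rightarrow> (nat \<Rightarrow> 'a) \<Rightarrow> nat set set" where
  "zero_sets k y = {P \<in> Pow {..<k}. (\<Oplus>j\<in>P. y j) = \<zero>}"

lemma finsum_indicator_mult:
  fixes k :: nat
  assumes "P \<subseteq> {..<k}" "y \<in> {..<k} \<rightarrow> carrier R"
  shows "(\<Oplus>j\<in>{..<k}. (if j \<in> P then \<one> else \<zero>) \<otimes> y j) = (\<Oplus>j\<in>P. y j)"
proof -
  have "(\<Oplus>j\<in>{..<k}. (if j \<in> P then \<one> else \<zero>) \<otimes> y j) = (\<Oplus>j\<in>{..<k}. if j \<in> P then y j else \<zero>)"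
    using assms by (intro finsum_cong') (auto simp: Pi_def)
  also have "\<dots> = (\<Oplus>j\<in>P. y j)"
    using assms by (intro extend_sum) auto
  finally show ?thesis .
qed

text \<open>Let \<open>y j \<noteq> \<zero>\<close>. Adding \<open>j\<close> to a set or removing it changes the sum of \<open>y\<close> over that set,
  so of the two sets that differ only in \<open>j\<close> at most one has sum zero.\<close>

lemma card_zero_sets:
  assumes y: "y \<in> {..<k} \<rightarrow> carrier R" and "j < k" "y j \<noteq> \<zero>"
  shows "2 * card (zero_sets k y) \<le> card (Pow {..<k})"
proof -
  \<comment> \<open>An involution on the subsets that maps zero sums to nonzero sums.\<close>
  define toggle where "toggle P = (if j \<in> P then P - {j} else insert j P)" for P
  have split: "(\<Oplus>i\<in>insert j P. y i) = y j \<oplus> (\<Oplus>i\<in>P. y i)" "(\<Oplus>i\<in>P. y i) \<in> carrier R"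
    if "P \<subseteq> {..<k}" "j \<notin> P" for P
  proof -
    have "finite P" using that by (rule_tac finite_subset) auto
    moreover have "y \<in> P \<rightarrow> carrier R" "y j \<in> carrier R" using y that \<open>j < k\<close> by auto
    ultimately show "(\<Oplus>i\<in>insert j P. y i) = y j \<oplus> (\<Oplus>i\<in>P. y i)" "(\<Oplus>i\<in>P. y i) \<in> carrier R"
      using that by (auto intro!: finsum_insert finsum_closed)
  qed
  have yj: "y j \<in> carrier R" using y \<open>j < k\<close> by auto
  have "toggle P \<in> Pow {..<k} - zero_sets k y" if "P \<in> zero_sets k y" for P
  proof (cases "j \<in> P")
    case True
    have "(\<Oplus>i\<in>insert j (P - {j}). y i) = \<zero>" "P \<subseteq> {..<k}"
      using that True by (auto simp: zero_sets_def insert_absorb)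
    then have "y j \<oplus> (\<Oplus>i\<in>P - {j}. y i) = \<zero>" using split(1)[of "P - {j}"] by force
    then have "(\<Oplus>i\<in>P - {j}. y i) \<noteq> \<zero>" using yj \<open>y j \<noteq> \<zero>\<close> by auto
    then show ?thesis using True \<open>P \<subseteq> {..<k}\<close> by (auto simp: toggle_def zero_sets_def)
  next
    case False
    then have "(\<Oplus>i\<in>insert j P. y i) = y j"
      using that split[of P] yj by (auto simp: zero_sets_def)
    then show ?thesis
      using that False \<open>j < k\<close> \<open>y j \<noteq> \<zero>\<close> by (auto simp: toggle_def zero_sets_def)
  qed
  moreover have "inj_on toggle (zero_sets k y)"
    by (rule inj_on_inverseI[of _ toggle]) (auto simp: toggle_def)
  ultimately have "card (zero_sets k y) \<le> card (Pow {..<k} - zero_sets k y)"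
    by (intro card_inj_on_le[of toggle]) auto
  moreover have "zero_sets k y \<subseteq> Pow {..<k}" by (auto simp: zero_sets_def)
  ultimately show ?thesis
    using card_Diff_subset[of "zero_sets k y" "Pow {..<k}"] card_mono[of "Pow {..<k}" "zero_sets k y"]
    by (simp add: finite_subset)
qed

text \<open>Each \<open>w P\<close> is a linear functional that vanishes on every member of \<open>B\<close> except \<open>P\<close>. Hence the
  indicator vectors of the members of \<open>B\<close> are linearly independent in a space of dimension
  \<open>k\<close>: applying \<open>w P\<close> to a linear relation isolates the coefficient of \<open>P\<close>.\<close>

lemma card_le_of_dual_family:
  assumes "finite B" "B \<subseteq> Pow {..<k}"
    and dual: "\<And>P. P \<in> B \<Longrightarrow> w P \<in> {..<k} \<rightarrow> carrier R \<and> B - {P} \<subseteq> zero_sets k (w P) \<and> P \<notin> zero_sets k (w P)"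
  shows "card B \<le> k"
proof (rule ccontr)
  assume "\<not> card B \<le> k"
  define b where "b = card B"
  obtain g where g: "bij_betw g {..<b} B"
    using ex_bij_betw_nat_finite[OF \<open>finite B\<close>] by (auto simp: b_def atLeast0LessThan)
  define A where "A i j = (if i \<in> g j then \<one> else \<zero>)" for i j
  obtain c j0 where c: "c \<in> {..<b} \<rightarrow>\<^sub>E carrier R" "j0 < b" "c j0 \<noteq> \<zero>"
    "\<And>i. i < k \<Longrightarrow> (\<Oplus>j\<in>{..<b}. A i j \<otimes> c j) = \<zero>"
  proof (rule ex_nontrivial_solution[of k b A])
    show "A i j \<in> carrier R" for i j by (simp add: A_def)
    show "k < b" using \<open>\<not> card B \<le> k\<close> by (simp add: b_def)
  qed blast
  define P y where "P = g j0" and "y = w P"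
  have P: "P \<in> B" using g c(2) by (auto simp: P_def bij_betw_def)
  have gB: "g j \<in> B" if "j < b" for j using g that by (auto simp: bij_betw_def)
  have y: "y \<in> {..<k} \<rightarrow> carrier R" using dual[OF P] by (simp add: y_def)
  have A_carrier: "A i j \<in> carrier R" for i j by (simp add: A_def)
  have c_carrier: "c j \<in> carrier R" if "j < b" for j using c(1) that by auto
  have y_carrier: "y i \<in> carrier R" if "i < k" for i using y that by auto
  have sum_y: "(\<Oplus>i\<in>Q. y i) \<in> carrier R" if "Q \<subseteq> {..<k}" for Q
    using y that by (intro finsum_closed) auto
  \<comment> \<open>Pair \<open>y\<close> with the linear relation \<open>c\<close> and exchange the two sums.\<close>
  have "\<zero> = (\<Oplus>i\<in>{..<k}. y i \<otimes> (\<Oplus>j\<in>{..<b}. A i j \<otimes> c j))"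
    by (rule finsum_all0[symmetric]) (use c(4) y_carrier in simp)
  also have "\<dots> = (\<Oplus>i\<in>{..<k}. \<Oplus>j\<in>{..<b}. y i \<otimes> (A i j \<otimes> c j))"
    using A_carrier c_carrier y_carrier by (intro finsum_cong' finsum_rdistr) (auto intro!: finsum_closed)
  also have "\<dots> = (\<Oplus>j\<in>{..<b}. \<Oplus>i\<in>{..<k}. y i \<otimes> (A i j \<otimes> c j))"
    using A_carrier c_carrier y_carrier by (intro finsum_finsum_swap) auto
  also have "\<dots> = (\<Oplus>j\<in>{..<b}. \<Oplus>i\<in>{..<k}. c j \<otimes> (A i j \<otimes> y i))"
    using A_carrier c_carrier y_carrier
    by (intro finsum_cong' refl) (auto intro!: finsum_closed simp: m_ac)
  also have "\<dots> = (\<Oplus>j\<in>{..<b}. c j \<otimes> (\<Oplus>i\<in>{..<k}. A i j \<otimes> y i))"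
    using A_carrier c_carrier y_carrier
    by (intro finsum_cong' finsum_rdistr[symmetric]) (auto intro!: finsum_closed)
  also have "\<dots> = (\<Oplus>j\<in>{..<b}. if j0 = j then c j \<otimes> (\<Oplus>i\<in>P. y i) else \<zero>)"
  proof (intro finsum_cong' refl)
    show "(\<lambda>j. if j0 = j then c j \<otimes> (\<Oplus>i\<in>P. y i) else \<zero>) \<in> {..<b} \<rightarrow> carrier R"
      using c_carrier sum_y P assms(2) by auto
    fix j assume "j \<in> {..<b}"
    then have "j < b" by simp
    have "(\<Oplus>i\<in>{..<k}. A i j \<otimes> y i) = (\<Oplus>i\<in>g j. y i)"
      unfolding A_def using gB[OF \<open>j < b\<close>] assms(2) y by (intro finsum_indicator_mult) auto
    moreover have "(\<Oplus>i\<in>g j. y i) = \<zero>" if "j0 \<noteq> j"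
    proof -
      have "g j \<noteq> P"
        using that g \<open>j < b\<close> c(2) by (auto simp: P_def bij_betw_def inj_on_def)
      then have "g j \<in> zero_sets k y" using dual[OF P] gB[OF \<open>j < b\<close>] by (auto simp: y_def)
      then show ?thesis by (simp add: zero_sets_def)
    qed
    ultimately show "c j \<otimes> (\<Oplus>i\<in>{..<k}. A i j \<otimes> y i) = (if j0 = j then c j \<otimes> (\<Oplus>i\<in>P. y i) else \<zero>)"
      using c_carrier[OF \<open>j < b\<close>] by (auto simp: P_def)
  qed
  also have "\<dots> = c j0 \<otimes> (\<Oplus>i\<in>P. y i)"
    using c_carrier c(2) sum_y P assms(2) by (intro finsum_singleton) auto
  finally have "c j0 \<otimes> (\<Oplus>i\<in>P. y i) = \<zero>" by simp
  moreover have "(\<Oplus>i\<in>P. y i) \<in> carrier R" using sum_y P assms(2) by blast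
  ultimately have "(\<Oplus>i\<in>P. y i) = \<zero>"
    using integral c(3) c_carrier[OF c(2)] by blast
  then show False
    using dual[OF P] P assms(2) by (auto simp: y_def zero_sets_def)
qed

text \<open>The 0/1-vectors in the linear span of \<open>B\<close>, described through the vectors orthogonal to \<open>B\<close>.\<close>

definition zero_sets_closure :: "nat \<Rightarrow> nat set set \<Rightarrow> nat set set" where
  "zero_sets_closure k B =
     {Q \<in> Pow {..<k}. \<forall>w\<in>{..<k} \<rightarrow> carrier R. B \<subseteq> zero_sets k w \<longrightarrow> Q \<in> zero_sets k w}"

text \<open>A generating set of the zero pattern that has the least possible size admits the functionals
  required by \<open>card_le_of_dual_family\<close>: leaving out \<open>P\<close> loses a member of the pattern, and the
  vector that witnesses this loss is orthogonal to all of \<open>B\<close> but \<open>P\<close>.\<close>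

lemma zero_sets_generated:
  assumes y: "y \<in> {..<k} \<rightarrow> carrier R"
  obtains B where "B \<subseteq> Pow {..<k}" "finite B" "card B \<le> k" "zero_sets_closure k B = zero_sets k y"
proof -
  define gen where "gen B \<longleftrightarrow> B \<subseteq> zero_sets k y \<and> zero_sets k y \<subseteq> zero_sets_closure k B" for B
  have "gen (zero_sets k y)" by (auto simp: gen_def zero_sets_closure_def zero_sets_def)
  then obtain B where B: "gen B" and minimal: "\<And>B'. gen B' \<Longrightarrow> card B \<le> card B'"
    using exists_least_iff[of "\<lambda>n. \<exists>B. gen B \<and> card B = n"] by (metis not_le)
  have sub: "B \<subseteq> Pow {..<k}" using B by (auto simp: gen_def zero_sets_def)
  then have "finite B" by (rule finite_subset) simp
  have "\<exists>w. w \<in> {..<k} \<rightarrow> carrier R \<and> B - {P} \<subseteq> zero_sets k w \<and> P \<notin> zero_sets k w" if "P \<in> B" for P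
  proof -
    have "\<not> gen (B - {P})"
      using minimal[of "B - {P}"] card_Diff1_less[OF \<open>finite B\<close> that] by auto
    then obtain Q where Q: "Q \<in> zero_sets k y" "Q \<notin> zero_sets_closure k (B - {P})"
      using B by (auto simp: gen_def)
    then obtain w where w: "w \<in> {..<k} \<rightarrow> carrier R" "B - {P} \<subseteq> zero_sets k w" "Q \<notin> zero_sets k w"
      by (auto simp: zero_sets_closure_def zero_sets_def)
    moreover have "Q \<in> zero_sets_closure k B" using B Q(1) by (auto simp: gen_def)
    ultimately have "P \<notin> zero_sets k w" by (auto simp: zero_sets_closure_def)
    with w show ?thesis by blast
  qed
  then obtain w where "\<And>P. P \<in> B \<Longrightarrow>
      w P \<in> {..<k} \<rightarrow> carrier R \<and> B - {P} \<subseteq> zero_sets k (w P) \<and> P \<notin> zero_sets k (w P)"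
    by metis
  then have "card B \<le> k" by (rule card_le_of_dual_family[OF \<open>finite B\<close> sub])
  moreover have "zero_sets_closure k B = zero_sets k y"
    using B y by (auto simp: gen_def zero_sets_closure_def)
  ultimately show ?thesis using that sub \<open>finite B\<close> by blast
qed

text \<open>A zero pattern is determined by at most \<open>k\<close> subsets of \<open>{..<k}\<close>, and there are
  \<open>2\<^sup>k\<close> candidates for each of them. The bound does not depend on the field, and this is what makes
  a counting argument possible over infinite fields.\<close>

lemma card_zero_patterns:
  shows "finite (zero_sets k ` ({..<k} \<rightarrow> carrier R))"
    and "card (zero_sets k ` ({..<k} \<rightarrow> carrier R)) \<le> 2 ^ k\<^sup>2"
proof -
  define F where "F = ({..<k} \<rightarrow>\<^sub>E Pow {..<k})"
  have "zero_sets k ` ({..<k} \<rightarrow> carrier R) \<subseteq> (\<lambda>f. zero_sets_closure k (f ` {..<k})) ` F"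
  proof
    fix Z assume "Z \<in> zero_sets k ` ({..<k} \<rightarrow> carrier R)"
    then obtain B where B: "B \<subseteq> Pow {..<k}" "finite B" "card B \<le> k" "zero_sets_closure k B = Z"
      using zero_sets_generated by (metis (no_types, lifting) imageE)
    obtain g where g: "bij_betw g {..<card B} B"
      using ex_bij_betw_nat_finite[OF \<open>finite B\<close>] by (auto simp: atLeast0LessThan)
    \<comment> \<open>Places beyond the size of \<open>B\<close> are filled with the empty set, which lies in every zero pattern.\<close>
    define f where "f = (\<lambda>i\<in>{..<k}. if i < card B then g i else {})"
    have "f i \<in> Pow {..<k}" if "i < k" for i
      using bij_betwE[OF g] B(1) that by (auto simp: f_def)
    then have "f \<in> F" by (auto simp: F_def f_def)
    have "{} \<in> zero_sets k w" for w by (simp add: zero_sets_def)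
    moreover have "B \<subseteq> f ` {..<k}"
    proof
      fix P assume "P \<in> B"
      then obtain i where "i < card B" "P = g i" using g by (auto simp: bij_betw_def)
      then show "P \<in> f ` {..<k}" using B(3) by (auto simp: f_def intro!: image_eqI[of _ _ i])
    qed
    moreover have "f ` {..<k} \<subseteq> insert {} B" using g by (auto simp: f_def bij_betw_def)
    ultimately have "f ` {..<k} \<subseteq> zero_sets k w \<longleftrightarrow> B \<subseteq> zero_sets k w" for w
      by (meson insert_subset order_trans)
    then have "Z = zero_sets_closure k (f ` {..<k})"
      unfolding B(4)[symmetric] by (simp add: zero_sets_closure_def)
    with \<open>f \<in> F\<close> show "Z \<in> (\<lambda>f. zero_sets_closure k (f ` {..<k})) ` F" by blast
  qed
  note covered = this
  have F: "finite F" "card F = 2 ^ k\<^sup>2"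
    by (simp_all add: F_def finite_PiE card_PiE card_Pow power_mult[symmetric] power2_eq_square)
  show "finite (zero_sets k ` ({..<k} \<rightarrow> carrier R))"
    by (rule finite_subset[OF covered finite_imageI[OF F(1)]])
  show "card (zero_sets k ` ({..<k} \<rightarrow> carrier R)) \<le> 2 ^ k\<^sup>2"
    using surj_card_le[OF F(1) covered] F(2) by simp
qed

end

section \<open>Separating labellings of the edges\<close>

text \<open>For uniformly random \<open>p, q \<in> U\<close> a fixed \<open>\<tau>\<close> satisfies \<open>p \<notin> \<tau> u\<close> and \<open>q \<notin> \<tau> v\<close> with
  probability at least \<open>1/2 \<cdot> 1/2\<close>, so on average at most three quarters of \<open>S\<close> remain. The
  averaging is carried out by counting the pairs of \<open>(p, q)\<close> and \<open>\<tau>\<close> in two ways.\<close>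

lemma ex_separating_pair:
  fixes U :: "'p set" and S :: "('v \<Rightarrow> 'p set) set"
  assumes "finite U" "U \<noteq> {}" "finite S"
    and small: "\<And>\<tau> w. \<tau> \<in> S \<Longrightarrow> w \<in> {u, v} \<Longrightarrow> \<tau> w \<subseteq> U \<and> 2 * card (\<tau> w) \<le> card U"
  obtains (separating) p q
    where "p \<in> U" "q \<in> U" "4 * card {\<tau>\<in>S. p \<in> \<tau> u \<or> q \<in> \<tau> v} \<le> 3 * card S"
proof (rule ccontr)
  define R where "R x \<tau> \<longleftrightarrow> fst x \<in> \<tau> u \<or> snd x \<in> \<tau> v" for x :: "'p \<times> 'p" and \<tau> :: "'v \<Rightarrow> 'p set"
  define N where "N = card U"
  assume contra: "\<not> thesis"
  have "3 * card S < 4 * card {\<tau>\<in>S. R x \<tau>}" if "x \<in> U \<times> U" for x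
  proof (rule ccontr)
    assume "\<not> ?thesis"
    then show False
      using contra separating[of "fst x" "snd x"] that by (auto simp: R_def)
  qed
  then have "(\<Sum>x\<in>U \<times> U. 3 * card S) < (\<Sum>x\<in>U \<times> U. 4 * card {\<tau>\<in>S. R x \<tau>})"
    using assms(1,2) by (intro sum_strict_mono) auto
  also have "\<dots> = 4 * (\<Sum>x\<in>U \<times> U. card {\<tau>\<in>S. R x \<tau>})"
    by (simp add: sum_distrib_left)
  also have "(\<Sum>x\<in>U \<times> U. card {\<tau>\<in>S. R x \<tau>}) = (\<Sum>\<tau>\<in>S. card {x\<in>U \<times> U. R x \<tau>})"
    using assms by (intro sum_multicount_gen) auto
  also have "4 * \<dots> = (\<Sum>\<tau>\<in>S. 4 * card {x\<in>U \<times> U. R x \<tau>})"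
    by (simp add: sum_distrib_left)
  also have "\<dots> \<le> (\<Sum>\<tau>\<in>S. 3 * N\<^sup>2)"
  proof (rule sum_mono)
    fix \<tau> assume "\<tau> \<in> S"
    define a b where "a = N - card (\<tau> u)" and "b = N - card (\<tau> v)"
    have "N \<le> 2 * a" "N \<le> 2 * b"
      using small[OF \<open>\<tau> \<in> S\<close>, of u] small[OF \<open>\<tau> \<in> S\<close>, of v] by (auto simp: a_def b_def N_def)
    then have "N\<^sup>2 \<le> 4 * (a * b)"
      using mult_mono[of N "2 * a" N "2 * b"] by (simp add: power2_eq_square)
    moreover have "{x\<in>U \<times> U. R x \<tau>} = U \<times> U - (U - \<tau> u) \<times> (U - \<tau> v)"
      by (auto simp: R_def)
    moreover have "card \<dots> = N\<^sup>2 - a * b"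
      using small[OF \<open>\<tau> \<in> S\<close>, of u] small[OF \<open>\<tau> \<in> S\<close>, of v] \<open>finite U\<close>
      by (subst card_Diff_subset)
        (auto simp: card_Diff_subset finite_subset a_def b_def N_def power2_eq_square)
    ultimately show "4 * card {x\<in>U \<times> U. R x \<tau>} \<le> 3 * N\<^sup>2" by simp
  qed
  also have "\<dots> = (\<Sum>x\<in>U \<times> U. 3 * card S)"
    by (simp add: N_def power2_eq_square card_cartesian_product)
  finally show False by simp
qed

text \<open>Labels are chosen edge by edge, and each edge removes at least a quarter of the functions that
  are still alive.\<close>

lemma ex_separating_labelling:
  fixes U :: "'p set" and T :: "('v \<Rightarrow> 'p set) set" and E :: "'v set set"
  assumes "finite E" and "\<And>e. e \<in> E \<Longrightarrow> e \<subseteq> V \<and> card e = 2"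
    and "finite U" "U \<noteq> {}" "finite T"
    and small: "\<And>\<tau> v. \<tau> \<in> T \<Longrightarrow> v \<in> V \<Longrightarrow> \<tau> v \<subseteq> U \<and> 2 * card (\<tau> v) \<le> card U"
  shows "\<exists>P. (\<forall>e\<in>E. \<forall>v\<in>e. P e v \<in> U) \<and>
    4 ^ card E * card {\<tau>\<in>T. \<forall>e\<in>E. \<exists>v\<in>e. P e v \<in> \<tau> v} \<le> 3 ^ card E * card T"
  using assms(1,2)
proof (induction E)
  case (insert e E)
  then obtain P where P: "\<forall>e\<in>E. \<forall>v\<in>e. P e v \<in> U"
    "4 ^ card E * card {\<tau>\<in>T. \<forall>e\<in>E. \<exists>v\<in>e. P e v \<in> \<tau> v} \<le> 3 ^ card E * card T" by auto
  define S where "S = {\<tau>\<in>T. \<forall>e\<in>E. \<exists>v\<in>e. P e v \<in> \<tau> v}"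
  obtain u v where e: "e = {u, v}" "u \<noteq> v" "{u, v} \<subseteq> V"
    using insert.prems[of e] by (auto simp: card_2_iff)
  obtain p q where pq: "p \<in> U" "q \<in> U" "4 * card {\<tau>\<in>S. p \<in> \<tau> u \<or> q \<in> \<tau> v} \<le> 3 * card S"
  proof (rule ex_separating_pair[of U S u v])
    show "finite S" using \<open>finite T\<close> by (simp add: S_def)
    show "\<tau> w \<subseteq> U \<and> 2 * card (\<tau> w) \<le> card U" if "\<tau> \<in> S" "w \<in> {u, v}" for \<tau> w
      using small that e(3) by (auto simp: S_def)
  qed (use assms in auto)
  define P' where "P' = P(e := \<lambda>w. if w = u then p else q)"
  have survivors: "{\<tau>\<in>T. \<forall>e\<in>insert e E. \<exists>v\<in>e. P' e v \<in> \<tau> v} = {\<tau>\<in>S. p \<in> \<tau> u \<or> q \<in> \<tau> v}"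
    using \<open>e \<notin> E\<close> e(2) by (auto simp: P'_def S_def e(1))
  have "4 ^ card (insert e E) * card {\<tau>\<in>S. p \<in> \<tau> u \<or> q \<in> \<tau> v} \<le> 4 ^ card E * (3 * card S)"
    using insert.hyps pq(3) by simp
  also have "4 ^ card E * (3 * card S) \<le> 3 ^ card (insert e E) * card T"
    using insert.hyps P(2) by (simp add: S_def)
  finally have "4 ^ card (insert e E) * card {\<tau>\<in>S. p \<in> \<tau> u \<or> q \<in> \<tau> v}
      \<le> 3 ^ card (insert e E) * card T" .
  moreover have "\<forall>e\<in>insert e E. \<forall>v\<in>e. P' e v \<in> U"
    using P(1) pq by (auto simp: P'_def)
  ultimately show ?case unfolding survivors[symmetric] by blast
qed auto

section \<open>Choosability over a field with involution\<close>

text \<open>Both inner products are instances of one sesquilinear form: \<open>\<sigma>\<close> is complex conjugation or the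
  identity.\<close>

locale field_with_involution = field F for F :: "'a ring" (structure) +
  fixes \<sigma> :: "'a \<Rightarrow> 'a"
  assumes involution_hom: "\<sigma> \<in> ring_hom F F"
    and involution: "x \<in> carrier F \<Longrightarrow> \<sigma> (\<sigma> x) = x"
begin

sublocale involution: ring_hom_cring F F \<sigma>
  by unfold_locales (rule involution_hom)

lemma involution_eq_zero_iff: "x \<in> carrier F \<Longrightarrow> \<sigma> x = \<zero> \<longleftrightarrow> x = \<zero>"
  using involution[of x] by auto

text \<open>In particular orthogonality is symmetric.\<close>

lemma inner_prod_commute:
  assumes "x \<in> {..<t} \<rightarrow> carrier F" "y \<in> {..<t} \<rightarrow> carrier F"
  shows "inner_prod F \<sigma> t y x = \<sigma> (inner_prod F \<sigma> t x y)"
proof -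
  have x: "x i \<in> carrier F" and y: "y i \<in> carrier F" if "i < t" for i
    using assms that by auto
  have "\<sigma> (inner_prod F \<sigma> t x y) = (\<Oplus>i\<in>{..<t}. \<sigma> (x i \<otimes> \<sigma> (y i)))"
    unfolding inner_prod_def using x y by (subst involution.hom_finsum) (auto simp: comp_def)
  also have "\<dots> = inner_prod F \<sigma> t y x"
    unfolding inner_prod_def using x y
    by (intro finsum_cong') (auto simp: involution m_comm)
  finally show ?thesis by simp
qed

text \<open>The subspace choice number is a least element, which carries information only if some \<open>k\<close> works.
  For \<open>k = card V\<close> the vectors can be chosen one vertex after the other, since orthogonality to the
  fewer than \<open>k\<close> earlier vectors is a system of fewer than \<open>k\<close> linear equations. The choice even
  makes vectors of nonadjacent vertices orthogonal.\<close>

lemma subspace_choosable_card: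
  assumes "finite V" and loopless: "\<And>u v. {u, v} \<in> E \<Longrightarrow> u \<in> V \<and> v \<in> V \<and> u \<noteq> v"
  shows "subspace_choosable V E F \<sigma> (card V)"
  unfolding subspace_choosable_def
proof (intro allI impI)
  fix t and W :: "'b \<Rightarrow> (nat \<Rightarrow> 'a) set"
  assume W: "\<forall>v\<in>V. subspace F (W v) (coord_space F t) \<and>
    vectorspace.dim F ((coord_space F t)\<lparr>carrier := W v\<rparr>) = card V"
  have W_carrier: "x \<in> {..<t} \<rightarrow> carrier F" if "x \<in> W v" "v \<in> V" for x v
  proof -
    have "W v \<subseteq> {..<t} \<rightarrow>\<^sub>E carrier F"
      using W that(2) by (simp add: subspace_def submodule_def)
    with that(1) show ?thesis by auto
  qed
  have "\<exists>x. (\<forall>v\<in>S. x v \<in> W v \<and> x v \<noteq> \<zero>\<^bsub>coord_space F t\<^esub>) \<and>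
      (\<forall>u\<in>S. \<forall>v\<in>S. u \<noteq> v \<longrightarrow> inner_prod F \<sigma> t (x u) (x v) = \<zero>)" if "finite S" "S \<subseteq> V" for S
    using that
  proof (induction S)
    case (insert v S)
    then obtain x where x: "\<And>u. u \<in> S \<Longrightarrow> x u \<in> W u \<and> x u \<noteq> \<zero>\<^bsub>coord_space F t\<^esub>"
      "\<And>u u'. u \<in> S \<Longrightarrow> u' \<in> S \<Longrightarrow> u \<noteq> u' \<Longrightarrow> inner_prod F \<sigma> t (x u) (x u') = \<zero>"
      unfolding insert_subset by blast
    have xc: "x u \<in> {..<t} \<rightarrow> carrier F" if "u \<in> S" for u
      using W_carrier[of "x u" u] x(1)[OF that] insert.prems that by auto
    obtain g where g: "bij_betw g {..<card S} S"
      using ex_bij_betw_nat_finite[OF insert.hyps(1)] by (auto simp: atLeast0LessThan)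
    define A where "A i j = \<sigma> (x (g i) j)" for i j
    have A: "A i j \<in> carrier F" if "i < card S" "j < t" for i j
      using xc[of "g i"] bij_betwE[OF g] that by (auto simp: A_def)
    have "card S < card V"
      using insert \<open>finite V\<close> by (intro psubset_card_mono) auto
    have "\<exists>z\<in>W v. z \<noteq> \<zero>\<^bsub>coord_space F t\<^esub> \<and> (\<forall>i<card S. (\<Oplus>j\<in>{..<t}. A i j \<otimes> z j) = \<zero>)"
    proof (rule ccontr)
      assume no_vector: "\<not> ?thesis"
      have "vectorspace.dim F ((coord_space F t)\<lparr>carrier := W v\<rparr>) \<le> card S"
      proof (rule subspace_dim_le_of_mat_map_kernel[OF A])
        show "subspace F (W v) (coord_space F t)" using W insert.prems by simp
        show "z = \<zero>\<^bsub>coord_space F t\<^esub>"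
          if "z \<in> W v" "\<forall>i<card S. (\<Oplus>j\<in>{..<t}. A i j \<otimes> z j) = \<zero>" for z
          using no_vector that by blast
      qed
      with \<open>card S < card V\<close> W insert.prems show False by simp
    qed
    then obtain z where z: "z \<in> W v" "z \<noteq> \<zero>\<^bsub>coord_space F t\<^esub>"
      "\<And>i. i < card S \<Longrightarrow> (\<Oplus>j\<in>{..<t}. A i j \<otimes> z j) = \<zero>" by blast
    have zc: "z \<in> {..<t} \<rightarrow> carrier F" using W_carrier[OF z(1)] insert.prems by simp
    have zx: "inner_prod F \<sigma> t z (x u) = \<zero>" if u: "u \<in> S" for u
    proof -
      have "u \<in> g ` {..<card S}"
        using u by (simp only: bij_betw_imp_surj_on[OF g])
      then obtain i where i: "i < card S" "g i = u" by (elim imageE) simp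
      have "inner_prod F \<sigma> t z (x u) = (\<Oplus>j\<in>{..<t}. A i j \<otimes> z j)"
        unfolding inner_prod_def using zc xc[OF u] i
        by (intro finsum_cong') (auto simp: A_def m_comm Pi_def)
      then show ?thesis using z(3) i(1) by simp
    qed
    moreover have "inner_prod F \<sigma> t (x u) z = \<zero>" if "u \<in> S" for u
      using inner_prod_commute[OF zc xc[OF that]] zx[OF that] by simp
    moreover have "(x(v := z)) u = x u" if "u \<in> S" for u
      using that insert.hyps(2) by auto
    ultimately show ?case
      using x z(1,2) by (intro exI[of _ "x(v := z)"]) (simp del: func_space_simps)
  qed simp
  from this[OF \<open>finite V\<close>] loopless
  show "\<exists>x. (\<forall>v\<in>V. x v \<in> W v \<and> x v \<noteq> \<zero>\<^bsub>coord_space F t\<^esub>) \<and>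
      (\<forall>u v. {u, v} \<in> E \<longrightarrow> inner_prod F \<sigma> t (x u) (x v) = \<zero>)"
    by blast
qed

text \<open>The vertex \<open>v\<close> receives the column space of the 0/1-matrix whose \<open>i\<close>-th row is the indicator
  vector of \<open>Q v i\<close>. A vector of this space is given by coefficients \<open>y v\<close>, and its \<open>i\<close>-th
  coordinate is the sum of \<open>y v\<close> over \<open>Q v i\<close>. The singleton rows give the matrix full column
  rank.\<close>

lemma subset_sums_of_subspace_choosable:
  fixes Q :: "'v \<Rightarrow> nat \<Rightarrow> nat set" and t k :: nat
  assumes choosable: "subspace_choosable V E F \<sigma> k"
    and Q: "\<And>v i. v \<in> V \<Longrightarrow> i < t \<Longrightarrow> Q v i \<subseteq> {..<k}"
    and singletons: "\<And>v j. v \<in> V \<Longrightarrow> j < k \<Longrightarrow> \<exists>i<t. Q v i = {j}"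
    and E: "\<And>u v. {u, v} \<in> E \<Longrightarrow> u \<in> V \<and> v \<in> V"
  obtains y where "\<And>v. v \<in> V \<Longrightarrow> y v \<in> {..<k} \<rightarrow> carrier F \<and> (\<exists>j<k. y v j \<noteq> \<zero>)"
    and "\<And>u v. {u, v} \<in> E \<Longrightarrow>
      (\<Oplus>i\<in>{..<t}. (\<Oplus>j\<in>Q u i. y u j) \<otimes> \<sigma> (\<Oplus>j\<in>Q v i. y v j)) = \<zero>"
proof -
  define A :: "'v \<Rightarrow> nat \<Rightarrow> nat \<Rightarrow> 'a" where "A v i j = (if j \<in> Q v i then \<one> else \<zero>)" for v i j
  define W where "W v = mat_map t k (A v) ` ({..<k} \<rightarrow>\<^sub>E carrier F)" for v
  have A_carrier: "A v i j \<in> carrier F" for v i j by (simp add: A_def)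
  have coord: "mat_map t k (A v) y i = (\<Oplus>j\<in>Q v i. y j)"
    if "v \<in> V" "i < t" "y \<in> {..<k} \<rightarrow>\<^sub>E carrier F" for v i y
    using that finsum_indicator_mult[OF Q[OF that(1,2)], of y]
    by (auto simp: mat_map_def A_def PiE_def)
  have sum_carrier: "(\<Oplus>j\<in>Q v i. y j) \<in> carrier F"
    if "v \<in> V" "i < t" "y \<in> {..<k} \<rightarrow>\<^sub>E carrier F" for v i y
    using Q[OF that(1,2)] that(3) by (intro finsum_closed) auto
  have inj: "y = \<zero>\<^bsub>func_space {..<k}\<^esub>"
    if "v \<in> V" and y: "y \<in> {..<k} \<rightarrow>\<^sub>E carrier F"
      and ker: "mat_map t k (A v) y = \<zero>\<^bsub>func_space {..<t}\<^esub>" for v y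
  proof -
    have "y j = \<zero>" if j: "j < k" for j
    proof -
      obtain i where i: "i < t" "Q v i = {j}" using singletons[OF \<open>v \<in> V\<close> j] by blast
      have "(\<Oplus>l\<in>Q v i. y l) = \<zero>"
        unfolding coord[OF \<open>v \<in> V\<close> i(1) y, symmetric] using ker i by simp
      moreover have "y j \<in> carrier F" using y j by auto
      ultimately show ?thesis unfolding i(2) by (simp add: finsum_insert)
    qed
    then have "y = (\<lambda>j\<in>{..<k}. \<zero>)"
      using y by (intro PiE_ext[where k = "{..<k}" and s = "\<lambda>_. carrier F"]) auto
    then show ?thesis by simp
  qed
  have "subspace F (W v) (coord_space F t) \<and>
      vectorspace.dim F ((coord_space F t)\<lparr>carrier := W v\<rparr>) = k" if "v \<in> V" for v
    unfolding W_def using mat_map_image_subspace[of t k "A v"] A_carrier inj[OF that] by blast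
  then obtain x where x: "\<And>v. v \<in> V \<Longrightarrow> x v \<in> W v \<and> x v \<noteq> \<zero>\<^bsub>coord_space F t\<^esub>"
    and orth: "\<And>u v. {u, v} \<in> E \<Longrightarrow> inner_prod F \<sigma> t (x u) (x v) = \<zero>"
    using choosable unfolding subspace_choosable_def by metis
  have "\<forall>v\<in>V. \<exists>y. y \<in> {..<k} \<rightarrow>\<^sub>E carrier F \<and> x v = mat_map t k (A v) y"
    using x by (auto simp: W_def)
  then obtain y where y: "\<And>v. v \<in> V \<Longrightarrow> y v \<in> {..<k} \<rightarrow>\<^sub>E carrier F"
    and xy: "\<And>v. v \<in> V \<Longrightarrow> x v = mat_map t k (A v) (y v)" by metis
  show ?thesis
  proof (rule that[of y], intro conjI)
    fix v assume v: "v \<in> V"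
    then show "y v \<in> {..<k} \<rightarrow> carrier F" using y by (auto simp: PiE_def)
    show "\<exists>j<k. y v j \<noteq> \<zero>"
    proof (rule ccontr)
      assume "\<not> ?thesis"
      then have "\<And>j. j < k \<Longrightarrow> y v j = \<zero>" by blast
      then have "mat_map t k (A v) (y v) = (\<lambda>i\<in>{..<t}. \<zero>)"
        unfolding mat_map_def using A_carrier by (intro restrict_ext finsum_all0) simp
      with x[OF v] xy[OF v] show False by simp
    qed
  next
    fix u v assume uv: "{u, v} \<in> E"
    then have V: "u \<in> V" "v \<in> V" using E by auto
    have "(\<Oplus>i\<in>{..<t}. (\<Oplus>j\<in>Q u i. y u j) \<otimes> \<sigma> (\<Oplus>j\<in>Q v i. y v j)) = inner_prod F \<sigma> t (x u) (x v)"
      unfolding inner_prod_def xy[OF V(1)] xy[OF V(2)]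
      using coord[OF V(1) _ y[OF V(1)]] coord[OF V(2) _ y[OF V(2)]]
        sum_carrier[OF V(1) _ y[OF V(1)]] sum_carrier[OF V(2) _ y[OF V(2)]]
      by (intro finsum_cong') auto
    then show "(\<Oplus>i\<in>{..<t}. (\<Oplus>j\<in>Q u i. y u j) \<otimes> \<sigma> (\<Oplus>j\<in>Q v i. y v j)) = \<zero>"
      using orth[OF uv] by simp
  qed
qed

end

section \<open>The lower bound\<close>

text \<open>The core of the lower bound. Every edge owns one coordinate, in which only its two ends have
  nonzero rows, so orthogonality along the edge means that one of two subset sums vanishes.
  With at least \<open>3 k\<^sup>2 card V\<close> edges the labels of the edges can be chosen such that this fails
  for every combination of zero patterns.\<close>

lemma (in field_with_involution) card_edges_less_of_subspace_choosable:
  assumes G: "simple_graph V E" and "V \<noteq> {}" and "0 < k"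
    and choosable: "subspace_choosable V E F \<sigma> k"
  shows "card E < 3 * k\<^sup>2 * card V"
proof (rule ccontr)
  assume "\<not> card E < 3 * k\<^sup>2 * card V"
  then have many_edges: "k\<^sup>2 * card V * 3 \<le> card E" by (simp add: mult.assoc mult.commute)
  have "finite V" and edge: "\<And>e. e \<in> E \<Longrightarrow> e \<subseteq> V \<and> card e = 2"
    using G by (auto simp: simple_graph_def)
  have "finite E"
    by (rule finite_subset[of _ "Pow V"]) (use edge \<open>finite V\<close> in auto)
  have "0 < card V" using \<open>finite V\<close> \<open>V \<noteq> {}\<close> by (simp add: card_gt_0_iff)
  define Y where "Y = {y \<in> {..<k} \<rightarrow> carrier F. \<exists>j<k. y j \<noteq> \<zero>}"
  \<comment> \<open>The possible assignments of zero patterns to the vertices.\<close>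
  define T where "T = (V \<rightarrow>\<^sub>E zero_sets k ` Y)"
  have patterns: "finite (zero_sets k ` Y)" "card (zero_sets k ` Y) \<le> 2 ^ k\<^sup>2"
  proof -
    have "zero_sets k ` Y \<subseteq> zero_sets k ` ({..<k} \<rightarrow> carrier F)" by (auto simp: Y_def)
    then show "finite (zero_sets k ` Y)" "card (zero_sets k ` Y) \<le> 2 ^ k\<^sup>2"
      using card_zero_patterns[of k] card_mono[of "zero_sets k ` ({..<k} \<rightarrow> carrier F)" "zero_sets k ` Y"]
      by (auto intro: finite_subset)
  qed
  have "finite T" using \<open>finite V\<close> patterns(1) by (simp add: T_def finite_PiE)
  have "card T = card (zero_sets k ` Y) ^ card V"
    using \<open>finite V\<close> by (simp add: T_def card_PiE)
  then have card_T: "card T \<le> 2 ^ (k\<^sup>2 * card V)"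
    using power_mono[OF patterns(2)] by (simp add: power_mult)
  have few_zeros: "\<tau> v \<subseteq> Pow {..<k} \<and> 2 * card (\<tau> v) \<le> card (Pow {..<k})" if "\<tau> \<in> T" "v \<in> V" for \<tau> v
  proof -
    have "\<tau> v \<in> zero_sets k ` Y" using that unfolding T_def by (rule PiE_mem)
    then obtain y j where y: "y \<in> {..<k} \<rightarrow> carrier F" "j < k" "y j \<noteq> \<zero>" "\<tau> v = zero_sets k y"
      unfolding Y_def by blast
    show ?thesis
      unfolding y(4) using card_zero_sets[OF y(1-3)] by (auto simp: zero_sets_def)
  qed
  have "\<exists>P. (\<forall>e\<in>E. \<forall>v\<in>e. P e v \<in> Pow {..<k}) \<and>
      4 ^ card E * card {\<tau>\<in>T. \<forall>e\<in>E. \<exists>v\<in>e. P e v \<in> \<tau> v} \<le> 3 ^ card E * card T"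
    by (rule ex_separating_labelling[OF \<open>finite E\<close> edge _ _ \<open>finite T\<close>]) (use few_zeros in auto)
  then obtain P where P: "\<And>e v. e \<in> E \<Longrightarrow> v \<in> e \<Longrightarrow> P e v \<subseteq> {..<k}"
    and survivors: "4 ^ card E * card {\<tau>\<in>T. \<forall>e\<in>E. \<exists>v\<in>e. P e v \<in> \<tau> v} \<le> 3 ^ card E * card T"
    by blast
  \<comment> \<open>After cubing, \<open>3\<^sup>3 \<cdot> 2 = 54 < 64 = 4\<^sup>3\<close>; the factor 3 in the number of edges is chosen for this.\<close>
  have "3 ^ card E * card T < 4 ^ card E"
  proof (rule power_less_imp_less_base)
    have "(card T) ^ 3 \<le> (2 ^ (k\<^sup>2 * card V)) ^ 3" by (rule power_mono[OF card_T]) simp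
    also have "\<dots> \<le> 2 ^ card E"
      unfolding power_mult[symmetric] by (rule power_increasing[OF many_edges]) simp
    finally have "(3 ^ card E * card T) ^ 3 \<le> (3 ^ card E) ^ 3 * 2 ^ card E"
      by (simp add: power_mult_distrib)
    also have "\<dots> = 54 ^ card E"
      by (simp add: power_mult[symmetric] mult.commute[of _ 3] power_mult power_mult_distrib[symmetric])
    also have "(54::nat) ^ card E < 64 ^ card E"
    proof (rule power_strict_mono)
      have "0 < k\<^sup>2 * card V * 3" using \<open>0 < k\<close> \<open>0 < card V\<close> by simp
      then show "0 < card E" using many_edges by linarith
    qed simp_all
    also have "\<dots> = (4 ^ card E) ^ 3"
      by (simp add: power_mult[symmetric] mult.commute[of _ 3] power_mult)
    finally show "(3 ^ card E * card T) ^ 3 < (4 ^ card E) ^ 3" .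
  qed simp
  then have "4 ^ card E * card {\<tau>\<in>T. \<forall>e\<in>E. \<exists>v\<in>e. P e v \<in> \<tau> v} < 4 ^ card E * 1"
    using survivors by linarith
  then have "card {\<tau>\<in>T. \<forall>e\<in>E. \<exists>v\<in>e. P e v \<in> \<tau> v} = 0" by simp
  then have no_survivor: "\<exists>e\<in>E. \<forall>v\<in>e. P e v \<notin> \<tau> v" if "\<tau> \<in> T" for \<tau>
    using \<open>finite T\<close> that by auto
  \<comment> \<open>One coordinate for each edge, and \<open>k\<close> private coordinates for each vertex.\<close>
  define I :: "('b set + 'b \<times> nat) set" where "I = Inl ` E \<union> Inr ` (V \<times> {..<k})"
  define t where "t = card I"
  have "finite I" using \<open>finite E\<close> \<open>finite V\<close> by (simp add: I_def)
  then obtain h where h: "bij_betw h {..<t} I"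
    using ex_bij_betw_nat_finite[of I] by (auto simp: t_def atLeast0LessThan)
  define Q where "Q v i = (case h i of Inl e \<Rightarrow> if v \<in> e then P e v else {}
      | Inr (w, j) \<Rightarrow> if w = v then {j} else {})" for v i
  have h_in: "h i \<in> I" if "i < t" for i using bij_betwE[OF h] that by simp
  have Q_sub: "Q v i \<subseteq> {..<k}" if "i < t" for v i
    using h_in[OF that] P unfolding Q_def I_def by (auto split: if_splits) blast+
  have ex_index: "\<exists>i<t. h i = a" if "a \<in> I" for a
  proof -
    have "a \<in> h ` {..<t}" using that by (simp only: bij_betw_imp_surj_on[OF h])
    then show ?thesis by auto
  qed
  have singletons: "\<exists>i<t. Q v i = {j}" if "v \<in> V" "j < k" for v j
  proof -
    have "Inr (v, j) \<in> I" using that by (simp add: I_def)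
    then obtain i where "i < t" "h i = Inr (v, j)" using ex_index by blast
    then show ?thesis by (auto simp: Q_def)
  qed
  have ends: "u \<in> V \<and> v \<in> V" if "{u, v} \<in> E" for u v using edge[OF that] by simp
  obtain y where y: "\<And>v. v \<in> V \<Longrightarrow> y v \<in> {..<k} \<rightarrow> carrier F \<and> (\<exists>j<k. y v j \<noteq> \<zero>)"
    and orth: "\<And>u v. {u, v} \<in> E \<Longrightarrow>
      (\<Oplus>i\<in>{..<t}. (\<Oplus>j\<in>Q u i. y u j) \<otimes> \<sigma> (\<Oplus>j\<in>Q v i. y v j)) = \<zero>"
    by (rule subset_sums_of_subspace_choosable[OF choosable Q_sub singletons ends]) auto
  define \<tau> where "\<tau> = (\<lambda>v\<in>V. zero_sets k (y v))"
  have "\<tau> \<in> T" using y by (auto simp: \<tau>_def T_def Y_def)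
  then obtain e where e: "e \<in> E" "\<And>v. v \<in> e \<Longrightarrow> P e v \<notin> \<tau> v" using no_survivor by blast
  obtain u v where uv: "e = {u, v}" "u \<noteq> v"
    using edge[OF e(1)] by (auto simp: card_2_iff)
  have V: "u \<in> V" "v \<in> V" using ends e(1) by (auto simp: uv(1))
  define s where "s w i = (\<Oplus>j\<in>Q w i. y w j)" for w i
  have s_carrier: "s w i \<in> carrier F" if "w \<in> V" "i < t" for w i
    unfolding s_def using Q_sub[OF that(2), of w] y[OF that(1)] by (intro finsum_closed) auto
  obtain i0 where i0: "i0 < t" "h i0 = Inl e" using ex_index[of "Inl e"] e(1) by (auto simp: I_def)
  have s_nonzero: "s w i0 \<noteq> \<zero>" if "w \<in> {u, v}" for w
  proof -
    have "w \<in> V" "w \<in> e" using that V uv(1) by auto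
    then have "P e w \<notin> zero_sets k (y w)" using e(2)[of w] by (simp add: \<tau>_def)
    moreover have "P e w \<subseteq> {..<k}" using P[OF e(1) \<open>w \<in> e\<close>] .
    ultimately show ?thesis using i0(2) \<open>w \<in> e\<close> by (simp add: s_def Q_def zero_sets_def)
  qed
  have disjoint: "Q u i = {} \<or> Q v i = {}" if "i < t" "i \<noteq> i0" for i
  proof (cases "h i")
    case (Inl e')
    have "e' \<in> E" using h_in[OF that(1)] Inl by (auto simp: I_def)
    have "e' \<noteq> e" using bij_betw_imp_inj_on[OF h] that i0 Inl by (auto simp: inj_on_def)
    have "\<not> (u \<in> e' \<and> v \<in> e')"
    proof
      assume "u \<in> e' \<and> v \<in> e'"
      then have "e \<subseteq> e'" using uv(1) by simp
      then show False
        using \<open>e' \<noteq> e\<close> edge[OF e(1)] edge[OF \<open>e' \<in> E\<close>] card_subset_eq[of e' e]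
        by (metis card.infinite zero_neq_numeral)
    qed
    then show ?thesis using Inl by (auto simp: Q_def)
  next
    case (Inr a)
    then show ?thesis using uv(2) by (cases a) (auto simp: Q_def)
  qed
  \<comment> \<open>Of the inner product only the term of the coordinate that belongs to \<open>e\<close> is left.\<close>
  have "\<zero> = (\<Oplus>i\<in>{..<t}. s u i \<otimes> \<sigma> (s v i))"
    using orth[of u v] e(1) by (simp add: s_def uv(1))
  also have "\<dots> = (\<Oplus>i\<in>{..<t}. if i0 = i then s u i \<otimes> \<sigma> (s v i) else \<zero>)"
  proof (intro finsum_cong' refl)
    show "(\<lambda>i. if i0 = i then s u i \<otimes> \<sigma> (s v i) else \<zero>) \<in> {..<t} \<rightarrow> carrier F"
      using s_carrier V by auto
    fix i assume "i \<in> {..<t}"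
    then have "i < t" by simp
    have "s u i = \<zero> \<or> s v i = \<zero>" if "i0 \<noteq> i"
      using disjoint[OF \<open>i < t\<close>] that by (auto simp: s_def)
    then show "s u i \<otimes> \<sigma> (s v i) = (if i0 = i then s u i \<otimes> \<sigma> (s v i) else \<zero>)"
      using s_carrier[OF V(1) \<open>i < t\<close>] s_carrier[OF V(2) \<open>i < t\<close>] by auto
  qed
  also have "\<dots> = s u i0 \<otimes> \<sigma> (s v i0)"
    using s_carrier V i0(1) by (intro finsum_singleton) auto
  finally have "s u i0 \<otimes> \<sigma> (s v i0) = \<zero>" by simp
  then have "s u i0 = \<zero> \<or> s v i0 = \<zero>"
    using s_carrier[OF V(1) i0(1)] s_carrier[OF V(2) i0(1)]
    by (simp add: integral_iff involution_eq_zero_iff)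
  then show False using s_nonzero by blast
qed

text \<open>The average degree is twice the number of edges per vertex, and there are fewer than \<open>3 k\<^sup>2\<close>
  edges per vertex when \<open>k\<close> is the subspace choice number.\<close>

lemma (in field_with_involution) sqrt_average_degree_less_subspace_choice_number:
  assumes G: "simple_graph V E" and "V \<noteq> {}"
  shows "sqrt (average_degree V E / 6) < real (subspace_choice_number V E F \<sigma>)"
proof -
  define k where "k = subspace_choice_number V E F \<sigma>"
  have "finite V" using G by (simp add: simple_graph_def)
  then have "0 < card V" using \<open>V \<noteq> {}\<close> by (simp add: card_gt_0_iff)
  have "u \<in> V \<and> v \<in> V \<and> u \<noteq> v" if "{u, v} \<in> E" for u v
  proof -
    have "{u, v} \<subseteq> V" "card {u, v} = 2" using G that by (auto simp: simple_graph_def)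
    then show ?thesis by (auto split: if_splits)
  qed
  then have "subspace_choosable V E F \<sigma> (card V)"
    by (rule subspace_choosable_card[OF \<open>finite V\<close>])
  with \<open>0 < card V\<close> have "0 < card V \<and> subspace_choosable V E F \<sigma> (card V)" by (rule conjI)
  then have k: "0 < k \<and> subspace_choosable V E F \<sigma> k"
    unfolding k_def subspace_choice_number_def by (rule LeastI)
  have "card E < 3 * k\<^sup>2 * card V"
    by (rule card_edges_less_of_subspace_choosable[OF assms conjunct1[OF k] conjunct2[OF k]])
  then have "real (card E) < real (3 * k\<^sup>2 * card V)" by (simp only: of_nat_less_iff)
  then have "average_degree V E / 6 < (real k)\<^sup>2"
    using \<open>0 < card V\<close> by (simp add: average_degree_def field_simps)
  then have "sqrt (average_degree V E / 6) < sqrt ((real k)\<^sup>2)" by (simp only: real_sqrt_less_iff)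
  then show ?thesis by (simp add: k_def)
qed

lemma complex_field_with_involution: "field_with_involution complex_field cnj"
proof -
  interpret field complex_field by (rule field_from_type_algebra)
  show ?thesis
    by unfold_locales (auto simp: ring_of_type_algebra_def ring_hom_def)
qed

lemma field_with_trivial_involution: "field F \<Longrightarrow> field_with_involution F id"
  by (auto simp: field_with_involution_def field_with_involution_axioms_def ring_hom_def)

text \<open>Since \<open>ln d \<ge> ln d\<^sub>0\<close>, the bound \<open>sqrt (d / 6)\<close> is at least
  \<open>sqrt (ln d\<^sub>0 / 6) \<cdot> sqrt (d / ln d)\<close>, which gives the constant.\<close>

theorem theorem1p2:
  shows "\<forall>d\<^sub>0 :: real. d\<^sub>0 > 1 \<longrightarrow>
    (\<exists>c :: real. c > 0 \<and>
      (\<forall>(V :: 'v set) (E :: 'v set set) (d :: real).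
         simple_graph V E \<and> d = average_degree V E \<and> d \<ge> d\<^sub>0 \<longrightarrow>
           real (subspace_choice_number V E complex_field cnj) > c * sqrt (d / ln d) \<and>
           (\<forall>F :: 'a ring. field F \<and> \<not> F \<simeq> complex_field \<longrightarrow>
              real (subspace_choice_number V E F id) > c * sqrt (d / ln d))))"
proof (intro allI impI)
  fix d\<^sub>0 :: real assume "d\<^sub>0 > 1"
  define c where "c = sqrt (ln d\<^sub>0 / 6)"
  show "\<exists>c > 0. \<forall>(V :: 'v set) (E :: 'v set set) d.
         simple_graph V E \<and> d = average_degree V E \<and> d \<ge> d\<^sub>0 \<longrightarrow>
           real (subspace_choice_number V E complex_field cnj) > c * sqrt (d / ln d) \<and>
           (\<forall>F :: 'a ring. field F \<and> \<not> F \<simeq> complex_field \<longrightarrow>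
              real (subspace_choice_number V E F id) > c * sqrt (d / ln d))"
  proof (intro exI[of _ c] conjI allI impI)
    show "c > 0" using \<open>d\<^sub>0 > 1\<close> by (simp add: c_def)
  next
    fix V :: "'v set" and E :: "'v set set" and d :: real
    assume *: "simple_graph V E \<and> d = average_degree V E \<and> d \<ge> d\<^sub>0"
    then have "V \<noteq> {}" using \<open>d\<^sub>0 > 1\<close> by (auto simp: average_degree_def)
    have "ln d\<^sub>0 \<le> ln d" "0 < ln d" "0 < d" using * \<open>d\<^sub>0 > 1\<close> by auto
    then have "d * ln d\<^sub>0 \<le> d * ln d" by (intro mult_left_mono) auto
    then have "(ln d\<^sub>0 / 6) * (d / ln d) \<le> d / 6"
      using \<open>0 < ln d\<close> by (simp add: field_simps)
    then have bound: "c * sqrt (d / ln d) \<le> sqrt (average_degree V E / 6)"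
      using * unfolding c_def by (metis real_sqrt_le_iff real_sqrt_mult)
    show "real (subspace_choice_number V E complex_field cnj) > c * sqrt (d / ln d)"
      using field_with_involution.sqrt_average_degree_less_subspace_choice_number
        [OF complex_field_with_involution _ \<open>V \<noteq> {}\<close>] * bound by (meson le_less_trans)
    show "real (subspace_choice_number V E F id) > c * sqrt (d / ln d)"
      if "field F \<and> \<not> F \<simeq> complex_field" for F :: "'a ring"
      using field_with_involution.sqrt_average_degree_less_subspace_choice_number
        [OF field_with_trivial_involution _ \<open>V \<noteq> {}\<close>] that * bound by (meson le_less_trans)
  qed
qed

end
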